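(* Let $0<m<n$. The asymptotic average train time-headway of the max-plus linear system with dynamic demand-dependent dwell times and controlled run times on a linear line, $$d^k_j=\max\left\{d^{k-b_j}_{j-1}+\tilde r_j+X_j\underline g_j,\ \ d^{k-\bar b_{j+1}}_{j+1}+\underline s_{j+1}\right\},$$ is given by the asymptotic average growth rate of the system; it depends on the number of trains $m$ on the line and on the passenger travel demand parameters $X=(X_j)_j$ as follows: $$h(m,X)=\max\left\{\frac{\sum_j(\underline g_jX_j+\tilde r_j)}{m},\ \ \max_j\big((\underline g_jX_j+\tilde r_j)+\underline s_j\big),\ \ \frac{\sum_j\underline s_j}{n-m}\right\}.$$
   Context: A linear metro line (no junction) is discretized as a closed loop of $n$ segments; segment $j$ connects nodes $j-1$ and $j$ (indices taken cyclically modulo $n$), and holds at most one train. $b_j\in\{0,1\}$ is the number of trains on segment $j$ at time zero, $\bar b_j=1-b_j$, and $m=\sum_j b_j$ is the number of trains. $d^k_j$ is the $k$-th departure time from node $j$; $h^k_j=d^k_j-d^{k-1}_j$. $\underline s_j$ is the minimum safe separation time, $\underline g_j$ the minimum dynamic interval (time without a train at the platform), $\underline r_j$ the minimum run time, $\tilde r_j=\underline r_j+\Delta r_j$ the nominal run time including the margin $\Delta r_j$. The demand parameter is $x_j=\lambda^{\rm out}_j/\alpha^{\rm out}_j+\lambda^{\rm in}_j/\alpha^{\rm in}_j\in[0,1)$ (average passenger departure/arrival rates over alighting/boarding capacities; $0$ if no platform), $X_j=x_j/(1-x_j)$. The displayed max-plus linear system is the form taken by the train dynamics with travel time $r^k_j+w^k_j$,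 $w^k_j=\min(x_jh^k_j,\bar w_j)$, $r^k_j=\max\{\underline r_j,\tilde r_j-x_j(h^k_j-\underline h_j)\}$ (where $\underline h_j=\underline g_j/(1-x_j)$, $\bar w_j=X_j\bar g_j$, $\bar g_j$ the maximum dynamic interval), under the standing conditions $h^1_j\le\bar g_j/(1-x_j)$ and $\Delta r_j\ge X_j(\bar g_j-\underline g_j)$ for all $j$. The asymptotic average growth rate is $h=\lim_{k\to\infty}d^k_j/k$, common to all $j$. *)

theory Defs
  imports Complex_Main
begin

text \<open>
  The line is a closed loop. Nodes and segments are both indexed by residues modulo
  \<open>n = segments L\<close>, represented by \<open>{..<n}\<close> (so the index \<open>n\<close> of the mathematical notation
  is \<open>0\<close> here), and segment \<open>j\<close> goes from node \<open>j - 1\<close> to node \<open>j\<close>.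
\<close>

record metro_line =
  segments :: nat
  occupancy :: "nat \<Rightarrow> nat"        \<comment> \<open>\<open>b\<^sub>j\<close>, trains on segment \<open>j\<close> at time zero\<close>
  safe_time :: "nat \<Rightarrow> real"       \<comment> \<open>minimum safe separation time \<open>s\<^sub>j\<close>\<close>
  dyn_interval :: "nat \<Rightarrow> real"    \<comment> \<open>minimum dynamic interval \<open>g\<^sub>j\<close>\<close>
  min_run_time :: "nat \<Rightarrow> real"    \<comment> \<open>minimum run time \<open>r\<^sub>j\<close>\<close>
  run_margin :: "nat \<Rightarrow> real"      \<comment> \<open>run time margin \<open>\<Delta>r\<^sub>j\<close>\<close>
  platform :: "nat \<Rightarrow> bool"
  out_rate :: "nat \<Rightarrow> real"        \<comment> \<open>average passenger departure rate\<close>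
  out_capacity :: "nat \<Rightarrow> real"    \<comment> \<open>alighting capacity\<close>
  in_rate :: "nat \<Rightarrow> real"         \<comment> \<open>average passenger arrival rate\<close>
  in_capacity :: "nat \<Rightarrow> real"     \<comment> \<open>boarding capacity\<close>

definition demand :: "metro_line \<Rightarrow> nat \<Rightarrow> real" where
  "demand L j =
     (if platform L j
      then out_rate L j / out_capacity L j + in_rate L j / in_capacity L j
      else 0)"

definition demand_X :: "metro_line \<Rightarrow> nat \<Rightarrow> real" where
  "demand_X L j = demand L j / (1 - demand L j)"

definition nominal_run_time :: "metro_line \<Rightarrow> nat \<Rightarrow> real" where
  "nominal_run_time L j = min_run_time L j + run_margin L j"

definition num_trains :: "metro_line \<Rightarrow> nat" where
  "num_trains L = (\<Sum>j<segments L. occupancy L j)"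

definition well_formed :: "metro_line \<Rightarrow> bool" where
  "well_formed L \<longleftrightarrow>
     (\<forall>j<segments L.
        occupancy L j \<in> {0, 1} \<and>
        (platform L j \<longrightarrow> 0 \<le> out_rate L j \<and> 0 < out_capacity L j \<and>
                         0 \<le> in_rate L j \<and> 0 < in_capacity L j) \<and>
        0 \<le> demand L j \<and> demand L j < 1)"

definition next_node :: "metro_line \<Rightarrow> nat \<Rightarrow> nat" where
  "next_node L j = (j + 1) mod segments L"

text \<open>\<open>segments L\<close> is added first because subtraction on \<^typ>\<open>nat\<close> truncates.\<close>

definition prev_node :: "metro_line \<Rightarrow> nat \<Rightarrow> nat" where
  "prev_node L j = (j + segments L - 1) mod segments L"

text \<open>
  \<open>d k j\<close> is the \<open>k\<close>-th departure time from node \<open>j\<close>. The recursion holds for \<open>k \<ge> 1\<close>, so that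
  no superscript below is negative; \<open>d 0\<close> is an arbitrary initial condition. The system is
  implicit: where a delay is \<open>0\<close>, the right-hand side refers to \<open>d k\<close> itself.
\<close>

definition maxplus_trajectory :: "metro_line \<Rightarrow> (nat \<Rightarrow> nat \<Rightarrow> real) \<Rightarrow> bool" where
  "maxplus_trajectory L d \<longleftrightarrow>
     (\<forall>k\<ge>1. \<forall>j<segments L.
        d k j =
          max (d (k - occupancy L j) (prev_node L j)
                 + nominal_run_time L j + demand_X L j * dyn_interval L j)
              (d (k - (1 - occupancy L (next_node L j))) (next_node L j)
                 + safe_time L (next_node L j)))"

definition has_growth_rate :: "metro_line \<Rightarrow> (nat \<Rightarrow> nat \<Rightarrow> real) \<Rightarrow> real \<Rightarrow> bool" where
  "has_growth_rate L d h \<longleftrightarrow> (\<forall>j<segments L. (\<lambda>k. d k j / real k) \<longlonglongrightarrow> h)"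

definition headway :: "(nat \<Rightarrow> nat \<Rightarrow> real) \<Rightarrow> nat \<Rightarrow> nat \<Rightarrow> real" where
  "headway d k j = d k j - d (k - 1) j"

definition has_average_headway :: "metro_line \<Rightarrow> (nat \<Rightarrow> nat \<Rightarrow> real) \<Rightarrow> real \<Rightarrow> bool" where
  "has_average_headway L d h \<longleftrightarrow>
     (\<forall>j<segments L. (\<lambda>K. (\<Sum>k=1..K. headway d k j) / real K) \<longlonglongrightarrow> h)"

definition headway_formula :: "metro_line \<Rightarrow> real" where
  "headway_formula L =
     Max {(\<Sum>j<segments L. dyn_interval L j * demand_X L j + nominal_run_time L j)
            / real (num_trains L),
          (MAX j\<in>{..<segments L}.
             (dyn_interval L j * demand_X L j + nominal_run_time L j) + safe_time L j),
          (\<Sum>j<segments L. safe_time L j) / (real (segments L) - real (num_trains L))}"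

end

theory Submission
  imports Defs
begin

text \<open>
  Each segment \<open>j\<close> contributes two arcs to the precedence graph of the recursion: a forward arc
  from node \<open>j - 1\<close> to node \<open>j\<close> of weight \<open>T\<^sub>j = r\<^sub>j + X\<^sub>j g\<^sub>j\<close> and delay \<open>b\<^sub>j\<close>, and a backward
  arc from node \<open>j\<close> to node \<open>j - 1\<close> of weight \<open>s\<^sub>j\<close> and delay \<open>1 - b\<^sub>j\<close>. The elementary circuits
  are the full forward loop, the full backward loop and the two-arc circuits on a single segment,
  and the three terms of the formula are their ratios of weight to delay. So the theorem says that
  the growth rate is the largest circuit ratio \<open>h\<close>.

  Subtract \<open>h\<close> times the delay from each weight. A potential \<open>v\<close> on the nodes makes all these
  reduced weights nonpositive if \<open>T\<^sub>j - h b\<^sub>j \<le> v\<^sub>j - v\<^sub>j\<^sub>-\<^sub>1 \<le> h (1 - b\<^sub>j) - s\<^sub>j\<close>.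
  Such a \<open>v\<close> exists: the lower bound lies below the upper one because of the two-arc circuits, and the increments can be chosen with
  sum \<open>0\<close> around the loop because the lower bounds have sum at most \<open>0\<close> (forward loop) and the
  upper bounds have sum at least \<open>0\<close> (backward loop); this is \<open>ex_potential\<close>.

  The quantity \<open>u\<^sup>k\<^sub>j = d\<^sup>k\<^sub>j - v\<^sub>j - h k\<close> is then bounded, whence both limits. It stays below its
  initial maximum, since every arc is nonincreasing for it and the arcs of delay \<open>0\<close> form no
  circuit when \<open>0 < m < n\<close> (\<open>bounded_above\<close>). It is bounded below because some circuit attains
  \<open>h\<close>, so that its arcs have no slack (\<open>bounded_below\<close>).
\<close>

section \<open>Cyclic indices\<close>

lemma prev_node_less: "0 < segments L \<Longrightarrow> prev_node L j < segments L"
  and next_node_less: "0 < segments L \<Longrightarrow> next_node L j < segments L"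
  by (simp_all add: prev_node_def next_node_def)

lemma next_prev_node: "j < segments L \<Longrightarrow> next_node L (prev_node L j) = j"
  by (simp add: prev_node_def next_node_def mod_simps)

lemma prev_next_node:
  assumes "j < segments L"
  shows "prev_node L (next_node L j) = j"
proof (cases "j + 1 = segments L")
  case True
  then show ?thesis by (auto simp: prev_node_def next_node_def)
next
  case False
  then show ?thesis using assms by (auto simp: prev_node_def next_node_def)
qed

lemma next_node_induct:
  assumes "a < segments L" "P a"
    and step: "\<And>j. j < segments L \<Longrightarrow> P j \<Longrightarrow> P (next_node L j)"
    and "j < segments L"
  shows "P j"
proof -
  have reach: "P ((a + i) mod segments L)" for i
  proof (induction i)
    case 0
    then show ?case using assms by simp
  next
    case (Suc i)
    have "(a + i) mod segments L < segments L"
      using assms by simp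
    from step[OF this Suc] show ?case
      by (simp add: next_node_def mod_simps)
  qed
  have "(a + (j + segments L - a)) mod segments L = j"
    using assms by simp
  then show ?thesis
    using reach[of "j + segments L - a"] by simp
qed

text \<open>The contrapositive turns closure under \<^const>\<open>prev_node\<close> into closure of the complement
  under \<^const>\<open>next_node\<close>.\<close>

lemma prev_node_induct:
  assumes "a < segments L" "P a"
    and step: "\<And>j. j < segments L \<Longrightarrow> P j \<Longrightarrow> P (prev_node L j)"
    and "j < segments L"
  shows "P j"
proof (rule ccontr)
  assume "\<not> P j"
  have "\<not> P a"
  proof (rule next_node_induct[where P = "\<lambda>i. \<not> P i"])
    show "\<not> P (next_node L i)" if "i < segments L" "\<not> P i" for i
      using step[of "next_node L i"] that next_node_less[of L i] prev_next_node[of i L] by auto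
  qed (use assms \<open>\<not> P j\<close> in auto)
  then show False using assms by simp
qed

lemma sum_prev_node: "(\<Sum>j<segments L. f (prev_node L j)) = (\<Sum>j<segments L. f j)"
  by (rule sum.reindex_bij_witness[where i = "next_node L" and j = "prev_node L"])
     (auto simp: prev_next_node next_prev_node intro!: prev_node_less next_node_less)

text \<open>A cyclic sequence of increments of total \<open>0\<close> is the difference sequence of its partial sums,
  which close up at node \<open>0\<close>.\<close>

lemma ex_cyclic_antidifference:
  fixes \<delta> :: "nat \<Rightarrow> real"
  assumes "(\<Sum>j<segments L. \<delta> j) = 0"
  shows "\<exists>v. \<forall>j<segments L. v j - v (prev_node L j) = \<delta> j"
proof (intro exI[of _ "\<lambda>j. \<Sum>i<Suc j. \<delta> i"] allI impI)
  fix j assume j: "j < segments L"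
  show "(\<Sum>i<Suc j. \<delta> i) - (\<Sum>i<Suc (prev_node L j). \<delta> i) = \<delta> j"
  proof (cases j)
    case 0
    then have "Suc (prev_node L j) = segments L"
      using j by (simp add: prev_node_def)
    then show ?thesis using assms 0 by simp
  next
    case (Suc i)
    then have "prev_node L j = i"
      using j by (simp add: prev_node_def)
    then show ?thesis using Suc by simp
  qed
qed

text \<open>The sum of a convex combination of \<open>A\<close> and \<open>B\<close> is affine in its parameter, so a suitable
  parameter makes it vanish.\<close>

lemma ex_between_sum_zero:
  fixes A B :: "nat \<Rightarrow> real"
  assumes le: "\<And>j. j < n \<Longrightarrow> A j \<le> B j"
    and neg: "(\<Sum>j<n. A j) \<le> 0" and pos: "0 \<le> (\<Sum>j<n. B j)"
  shows "\<exists>\<delta>. (\<forall>j<n. A j \<le> \<delta> j \<and> \<delta> j \<le> B j) \<and> (\<Sum>j<n. \<delta> j) = 0"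
proof (cases "(\<Sum>j<n. A j) = 0")
  case True
  then show ?thesis using le by auto
next
  case False
  define a where "a = (\<Sum>j<n. A j)"
  define b where "b = (\<Sum>j<n. B j)"
  define t where "t = - a / (b - a)"
  have ab: "a < 0" "0 \<le> b"
    using False neg pos by (auto simp: a_def b_def)
  then have t: "0 \<le> t" "t \<le> 1" "a + t * (b - a) = 0"
    by (auto simp: t_def field_simps)
  have "A j \<le> A j + t * (B j - A j) \<and> A j + t * (B j - A j) \<le> B j" if "j < n" for j
    using mult_left_le_one_le[of "B j - A j" t] le[OF that] t by auto
  moreover have "(\<Sum>j<n. A j + t * (B j - A j)) = 0"
    using t(3) by (simp add: sum.distrib sum_distrib_left[symmetric] sum_subtractf a_def b_def)
  ultimately show ?thesis
    by (intro exI[of _ "\<lambda>j. A j + t * (B j - A j)"]) simp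
qed

section \<open>Circuit ratios and the potential\<close>

locale metro_trajectory =
  fixes L :: metro_line and d :: "nat \<Rightarrow> nat \<Rightarrow> real"
  assumes wf: "well_formed L"
    and trains_pos: "0 < num_trains L" and trains_less: "num_trains L < segments L"
    and traj: "maxplus_trajectory L d"
begin

abbreviation n where "n \<equiv> segments L"
abbreviation m where "m \<equiv> num_trains L"
abbreviation b where "b \<equiv> occupancy L"
abbreviation s where "s \<equiv> safe_time L"
abbreviation prv where "prv \<equiv> prev_node L"
abbreviation nxt where "nxt \<equiv> next_node L"
abbreviation h where "h \<equiv> headway_formula L"

definition T :: "nat \<Rightarrow> real" where
  "T j = dyn_interval L j * demand_X L j + nominal_run_time L j"

text \<open>The weights of the two arcs of segment \<open>j\<close>, reduced by \<open>h\<close> per unit of delay; the backward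
  one is negated, since it bounds the increment of a potential from above.\<close>

definition A :: "nat \<Rightarrow> real" where "A j = T j - h * real (b j)"
definition B :: "nat \<Rightarrow> real" where "B j = h * (1 - real (b j)) - s j"

lemma n_pos: "0 < n"
  using trains_less by simp

lemma b_cases:
  assumes "j < n"
  obtains "b j = 0" | "b j = 1"
  using wf assms by (auto simp: well_formed_def)

lemma forward_arc:
  assumes "1 \<le> k" "j < n"
  shows "d (k - b j) (prv j) + T j \<le> d k j"
  using traj assms by (auto simp: maxplus_trajectory_def T_def algebra_simps)

lemma backward_arc:
  assumes "1 \<le> k" "j < n"
  shows "d (k - (1 - b j)) j + s j \<le> d k (prv j)"
proof -
  have "d (k - (1 - b (nxt (prv j)))) (nxt (prv j)) + s (nxt (prv j)) \<le> d k (prv j)"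
    using traj assms prev_node_less[OF n_pos, of j] by (auto simp: maxplus_trajectory_def)
  then show ?thesis using assms by (simp add: next_prev_node)
qed

lemma some_arc_attained:
  assumes "1 \<le> k" "j < n"
  shows "d k j = d (k - b j) (prv j) + T j \<or>
         d k j = d (k - (1 - b (nxt j))) (nxt j) + s (nxt j)"
  using traj assms by (auto simp: maxplus_trajectory_def T_def algebra_simps max_def)

lemma ex_occupied: obtains p where "p < n" "b p = 1"
proof -
  have "m = 0" if "\<forall>p<n. b p = 0"
    using that by (simp add: num_trains_def)
  then have "\<not> (\<forall>p<n. b p = 0)"
    using trains_pos by (metis less_irrefl)
  then show ?thesis using that b_cases by metis
qed

lemma ex_free: obtains p where "p < n" "b p = 0"
proof -
  have "m = n" if "\<forall>p<n. b p = 1"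
    using that by (simp add: num_trains_def)
  then have "\<not> (\<forall>p<n. b p = 1)"
    using trains_less by (metis less_irrefl)
  then show ?thesis using that b_cases by metis
qed

lemma headway_formula_eq:
  "h = Max {(\<Sum>j<n. T j) / real m, (MAX j\<in>{..<n}. T j + s j), (\<Sum>j<n. s j) / (real n - real m)}"
  by (simp add: headway_formula_def T_def)

lemma ratio_le_h:
  shows forward_ratio_le: "(\<Sum>j<n. T j) \<le> h * real m"
    and backward_ratio_le: "(\<Sum>j<n. s j) \<le> h * (real n - real m)"
    and two_arc_ratio_le: "j < n \<Longrightarrow> T j + s j \<le> h"
proof -
  have "(\<Sum>j<n. T j) / real m \<le> h" "(\<Sum>j<n. s j) / (real n - real m) \<le> h"
    and two: "(MAX j\<in>{..<n}. T j + s j) \<le> h"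
    unfolding headway_formula_eq by (auto intro: Max_ge)
  then show "(\<Sum>j<n. T j) \<le> h * real m" "(\<Sum>j<n. s j) \<le> h * (real n - real m)"
    using trains_pos trains_less by (auto simp: divide_simps split: if_splits)
  have "T j + s j \<le> (MAX j\<in>{..<n}. T j + s j)" if "j < n"
    using that by (intro Max_ge) auto
  then show "j < n \<Longrightarrow> T j + s j \<le> h" using two by (rule order_trans)
qed

lemma critical_circuit:
  obtains (forward) "(\<Sum>j<n. T j) = h * real m"
  | (backward) "(\<Sum>j<n. s j) = h * (real n - real m)"
  | (two_arc) p where "p < n" "T p + s p = h"
proof -
  have "h \<in> {(\<Sum>j<n. T j) / real m, (MAX j\<in>{..<n}. T j + s j),
      (\<Sum>j<n. s j) / (real n - real m)}"
    unfolding headway_formula_eq by (rule Max_in) auto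
  then consider "h = (\<Sum>j<n. T j) / real m" | "h = (MAX j\<in>{..<n}. T j + s j)"
    | "h = (\<Sum>j<n. s j) / (real n - real m)" by blast
  then show thesis
  proof cases
    case 1
    then show thesis using forward trains_pos by simp
  next
    case 2
    have "(MAX j\<in>{..<n}. T j + s j) \<in> (\<lambda>j. T j + s j) ` {..<n}"
      using n_pos by (intro Max_in) auto
    then show thesis using 2 two_arc by fastforce
  next
    case 3
    then show thesis using backward trains_less by simp
  qed
qed

lemma sum_A: "(\<Sum>j<n. A j) = (\<Sum>j<n. T j) - h * real m"
  by (simp add: A_def sum_subtractf sum_distrib_left num_trains_def)

lemma sum_B: "(\<Sum>j<n. B j) = h * (real n - real m) - (\<Sum>j<n. s j)"
  by (simp add: B_def sum_subtractf sum_distrib_left[symmetric] num_trains_def)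

lemma ex_potential: "\<exists>v. \<forall>j<n. A j \<le> v j - v (prv j) \<and> v j - v (prv j) \<le> B j"
proof -
  have "A j \<le> B j" if "j < n" for j
    using two_arc_ratio_le[OF that] by (simp add: A_def B_def algebra_simps)
  then obtain \<delta> where \<delta>: "\<forall>j<n. A j \<le> \<delta> j \<and> \<delta> j \<le> B j" "(\<Sum>j<n. \<delta> j) = 0"
    using ex_between_sum_zero[of n A B] forward_ratio_le backward_ratio_le
    by (auto simp: sum_A sum_B)
  then show ?thesis using ex_cyclic_antidifference[OF \<delta>(2)] by metis
qed

end

section \<open>Boundedness of the normalized departure times\<close>

locale metro_potential = metro_trajectory +
  fixes v :: "nat \<Rightarrow> real"
  assumes A_le: "\<And>j. j < n \<Longrightarrow> A j \<le> v j - v (prv j)"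
    and le_B: "\<And>j. j < n \<Longrightarrow> v j - v (prv j) \<le> B j"
begin

definition u :: "nat \<Rightarrow> nat \<Rightarrow> real" where
  "u k j = d k j - v j - h * real k"

definition forward_slack :: "nat \<Rightarrow> real" where
  "forward_slack j = v j - v (prv j) - A j"

definition backward_slack :: "nat \<Rightarrow> real" where
  "backward_slack j = B j - (v j - v (prv j))"

lemma u_forward:
  assumes "1 \<le> k" "j < n"
  shows "u (k - b j) (prv j) - forward_slack j \<le> u k j"
  using forward_arc[OF assms] assms
  by (cases rule: b_cases[OF assms(2)])
     (auto simp: u_def forward_slack_def A_def of_nat_diff algebra_simps)

lemma u_backward:
  assumes "1 \<le> k" "j < n"
  shows "u (k - (1 - b j)) j - backward_slack j \<le> u k (prv j)"
  using backward_arc[OF assms] assms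
  by (cases rule: b_cases[OF assms(2)])
     (auto simp: u_def backward_slack_def B_def of_nat_diff algebra_simps)

lemma u_le_some_arc:
  assumes "1 \<le> k" "j < n"
  shows "u k j \<le> u (k - b j) (prv j) \<or> u k j \<le> u (k - (1 - b (nxt j))) (nxt j)"
  using some_arc_attained[OF assms]
proof
  assume "d k j = d (k - b j) (prv j) + T j"
  then have "u k j \<le> u (k - b j) (prv j)"
    using A_le[OF assms(2)] assms(1)
    by (cases rule: b_cases[OF assms(2)]) (auto simp: u_def A_def of_nat_diff algebra_simps)
  then show ?thesis ..
next
  have nj: "nxt j < n" using next_node_less[OF n_pos] .
  assume "d k j = d (k - (1 - b (nxt j))) (nxt j) + s (nxt j)"
  then have "u k j \<le> u (k - (1 - b (nxt j))) (nxt j)"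
    using le_B[OF nj] assms
    by (cases rule: b_cases[OF nj])
       (auto simp: u_def B_def of_nat_diff prev_next_node algebra_simps)
  then show ?thesis ..
qed

text \<open>
  A node exceeding \<open>C\<close> at time \<open>k\<close> inherits the excess through an arc of delay \<open>0\<close>, as all arcs of
  delay \<open>1\<close> come from time \<open>k - 1\<close>. On one segment only one of the two arcs has delay \<open>0\<close>, so the
  trace cannot turn back; it runs through the whole loop in one direction, which would require all
  segments to be free, or all to be occupied.
\<close>

lemma u_le_step:
  assumes k: "1 \<le> k" and prev: "\<And>j. j < n \<Longrightarrow> u (k - 1) j \<le> C" and j: "j < n"
  shows "u k j \<le> C"
proof (rule ccontr)
  have pl: "prv i < n" and nl: "nxt i < n" for i
    using prev_node_less[OF n_pos] next_node_less[OF n_pos] by auto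
  have trace: "b i = 0 \<and> C < u k (prv i) \<or> b (nxt i) = 1 \<and> C < u k (nxt i)"
    if i: "i < n" and "C < u k i" for i
    using u_le_some_arc[OF k i] \<open>C < u k i\<close> prev[OF pl[of i]] prev[OF nl[of i]]
    by (cases rule: b_cases[OF i]; cases rule: b_cases[OF nl[of i]]) auto
  assume "\<not> u k j \<le> C"
  then consider "b j = 0" "C < u k (prv j)" | "b (nxt j) = 1" "C < u k (nxt j)"
    using trace[OF j] by auto
  then show False
  proof cases
    case 1
    have "b (nxt i) = 0 \<and> C < u k i" if "i < n" for i
    proof (rule prev_node_induct[OF pl _ _ that])
      show "b (nxt (prv j)) = 0 \<and> C < u k (prv j)"
        using 1 j by (simp add: next_prev_node)
      show "b (nxt (prv i)) = 0 \<and> C < u k (prv i)" if "i < n" "b (nxt i) = 0 \<and> C < u k i" for i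
        using that trace[of i] by (auto simp: next_prev_node)
    qed
    then have "b i = 0" if "i < n" for i
      using pl[of i] next_prev_node[OF that] by metis
    then show False using ex_occupied by force
  next
    case 2
    have "b i = 1 \<and> C < u k i" if "i < n" for i
    proof (rule next_node_induct[OF nl _ _ that])
      show "b (nxt j) = 1 \<and> C < u k (nxt j)"
        using 2 by simp
      show "b (nxt i) = 1 \<and> C < u k (nxt i)" if "i < n" "b i = 1 \<and> C < u k i" for i
        using that trace[of i] by auto
    qed
    then show False using ex_free by force
  qed
qed

lemma bounded_above: "\<exists>C. \<forall>k. \<forall>j<n. u k j \<le> C"
proof (rule exI[of _ "MAX j\<in>{..<n}. u 0 j"], rule allI)
  fix k
  show "\<forall>j<n. u k j \<le> (MAX j\<in>{..<n}. u 0 j)"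
  proof (induction k)
    case 0
    then show ?case by (auto intro: Max_ge)
  next
    case (Suc k)
    then show ?case using u_le_step[of "Suc k" "MAX j\<in>{..<n}. u 0 j"] by auto
  qed
qed

text \<open>A full loop is critical exactly when its slacks, which are nonnegative, have sum \<open>0\<close>.\<close>

lemma forward_loop_tight:
  assumes "(\<Sum>j<n. T j) = h * real m" "j < n"
  shows "forward_slack j = 0"
proof -
  have "(\<Sum>j<n. forward_slack j) = 0"
    using assms(1) sum_prev_node[of v L] by (simp add: forward_slack_def sum_subtractf sum_A)
  moreover have "0 \<le> forward_slack i" if "i < n" for i
    using A_le[OF that] by (simp add: forward_slack_def)
  ultimately show ?thesis
    using assms(2) sum_nonneg_eq_0_iff[of "{..<n}" forward_slack] by auto
qed

lemma backward_loop_tight: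
  assumes "(\<Sum>j<n. s j) = h * (real n - real m)" "j < n"
  shows "backward_slack j = 0"
proof -
  have "(\<Sum>j<n. backward_slack j) = 0"
    using assms(1) sum_prev_node[of v L] by (simp add: backward_slack_def sum_subtractf sum_B)
  moreover have "0 \<le> backward_slack i" if "i < n" for i
    using le_B[OF that] by (simp add: backward_slack_def)
  ultimately show ?thesis
    using assms(2) sum_nonneg_eq_0_iff[of "{..<n}" backward_slack] by auto
qed

text \<open>One node suffices for a lower bound: the forward arcs reach all the others from it, at the
  cost of their slacks.\<close>

lemma bounded_below_spreads:
  assumes "p < n" "\<exists>C. \<forall>k. C \<le> u k p" "j < n"
  shows "\<exists>C. \<forall>k. C \<le> u k j"
proof (rule next_node_induct[where P = "\<lambda>j. \<exists>C. \<forall>k. C \<le> u k j"])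
  fix i assume i: "i < n" and "\<exists>C. \<forall>k. C \<le> u k i"
  then obtain C where C: "\<And>k. C \<le> u k i" by blast
  have "min (C - forward_slack (nxt i)) (u 0 (nxt i)) \<le> u k (nxt i)" for k
  proof (cases "k = 0")
    case False
    then show ?thesis
      using u_forward[of k "nxt i"] C[of "k - b (nxt i)"] next_node_less[OF n_pos, of i]
      by (simp add: prev_next_node[OF i])
  qed simp
  then show "\<exists>C. \<forall>k. C \<le> u k (nxt i)" by blast
qed (use assms in auto)

text \<open>
  Without slack, a forward loop passes lower bounds on: an occupied segment, whose forward arc has
  delay \<open>1\<close>, imports the bound from time \<open>k - 1\<close>, and the arcs after it carry the bound around the
  loop. For the backward loop, a free segment does this. A critical two-arc circuit on segment \<open>p\<close>
  has total delay \<open>1\<close>, so \<open>u\<close> does not decrease in time at node \<open>p\<close>, except possibly from time \<open>0\<close>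
  to time \<open>1\<close>.
\<close>

lemma bounded_below: "j < n \<Longrightarrow> \<exists>C. \<forall>k. C \<le> u k j"
proof -
  assume j: "j < n"
  let ?C = "MIN j\<in>{..<n}. u 0 j"
  have start: "\<forall>j<n. ?C \<le> u 0 j"
    by (auto intro: Min_le)
  show ?thesis
  proof (cases rule: critical_circuit)
    case forward
    obtain p where p: "p < n" "b p = 1" by (rule ex_occupied)
    have arc: "u (k - b i) (prv i) \<le> u k i" if "1 \<le> k" "i < n" for k i
      using u_forward[OF that] forward_loop_tight[OF forward that(2)] by simp
    have "\<forall>j<n. ?C \<le> u k j" for k
    proof (induction k)
      case 0
      show ?case by (fact start)
    next
      case (Suc k)
      have "?C \<le> u (Suc k) p"
        using arc[of "Suc k" p] p Suc prev_node_less[OF n_pos, of p] by fastforce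
      moreover have "?C \<le> u (Suc k) (nxt i)" if i: "i < n" and "?C \<le> u (Suc k) i" for i
      proof -
        have ni: "nxt i < n" by (rule next_node_less[OF n_pos])
        have "u (Suc k - b (nxt i)) i \<le> u (Suc k) (nxt i)"
          using arc[of "Suc k" "nxt i"] ni prev_next_node[OF i] by simp
        moreover have "?C \<le> u k i" using Suc i by blast
        ultimately show ?thesis
          using that by (cases rule: b_cases[OF ni]) auto
      qed
      ultimately show ?case
        using next_node_induct[OF p(1), of "\<lambda>i. ?C \<le> u (Suc k) i"] by simp
    qed
    then show ?thesis using j by blast
  next
    case backward
    obtain p where p: "p < n" "b p = 0" by (rule ex_free)
    have arc: "u (k - (1 - b i)) i \<le> u k (prv i)" if "1 \<le> k" "i < n" for k i
      using u_backward[OF that] backward_loop_tight[OF backward that(2)] by simp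
    have "\<forall>j<n. ?C \<le> u k j" for k
    proof (induction k)
      case 0
      show ?case by (fact start)
    next
      case (Suc k)
      have "?C \<le> u (Suc k) (prv p)"
        using arc[of "Suc k" p] p Suc by fastforce
      moreover have "?C \<le> u (Suc k) (prv i)" if i: "i < n" and "?C \<le> u (Suc k) i" for i
      proof -
        have "?C \<le> u k i" using Suc i by blast
        then show ?thesis
          using that arc[of "Suc k" i] by (cases rule: b_cases[OF i]) auto
      qed
      ultimately show ?case
        using prev_node_induct[OF prev_node_less[OF n_pos, of p], of "\<lambda>i. ?C \<le> u (Suc k) i"]
        by simp
    qed
    then show ?thesis using j by blast
  next
    case (two_arc p)
    have "A p = B p"
      using two_arc(2) by (simp add: A_def B_def algebra_simps)
    then have tight: "forward_slack p = 0" "backward_slack p = 0"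
      using A_le[OF two_arc(1)] le_B[OF two_arc(1)]
      by (auto simp: forward_slack_def backward_slack_def)
    have incr: "u k p \<le> u (Suc k) p" if "1 \<le> k" for k
      \<comment> \<open>If segment \<open>p\<close> is occupied, its backward arc has delay \<open>0\<close> and is used at time \<open>k\<close>
         itself, where the recursion needs \<open>k \<ge> 1\<close>.\<close>
      using u_forward[of "Suc k" p] u_backward[of k p] u_backward[of "Suc k" p]
        tight two_arc(1) that
      by (cases rule: b_cases[OF two_arc(1)]) auto
    have "min (u 0 p) (u 1 p) \<le> u k p" for k
    proof (induction k)
      case (Suc k)
      then show ?case using incr[of k] by (cases "k = 0") auto
    qed simp
    then show ?thesis
      using bounded_below_spreads[OF two_arc(1) _ j] by blast
  qed
qed

lemma growth_rate: "has_growth_rate L d h"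
  unfolding has_growth_rate_def
proof (intro allI impI)
  fix j assume j: "j < n"
  obtain C where C: "\<And>k. u k j \<le> C" using bounded_above j by blast
  obtain c where c: "\<And>k. c \<le> u k j" using bounded_below[OF j] by blast
  have "(\<lambda>k. u k j / real k) \<longlonglongrightarrow> 0"
  proof (rule tendsto_sandwich)
    show "(\<lambda>k. c / real k) \<longlonglongrightarrow> 0" "(\<lambda>k. C / real k) \<longlonglongrightarrow> 0"
      by (rule lim_const_over_n)+
  qed (auto intro!: always_eventually divide_right_mono simp: c C)
  then have "(\<lambda>k. u k j / real k + v j / real k + h) \<longlonglongrightarrow> 0 + 0 + h"
    by (intro tendsto_intros lim_const_over_n)
  moreover have "\<forall>\<^sub>F k in sequentially. u k j / real k + v j / real k + h = d k j / real k"
    using eventually_gt_at_top[of 0]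
    by eventually_elim (simp add: u_def field_simps)
  ultimately show "(\<lambda>k. d k j / real k) \<longlonglongrightarrow> h"
    by (simp add: tendsto_cong)
qed

end

section \<open>The average headway\<close>

lemma sum_headway: "(\<Sum>k=1..K. headway d k j) = d K j - d 0 j"
  by (induction K) (simp_all add: headway_def)

lemma has_average_headway_if_has_growth_rate:
  assumes "has_growth_rate L d h"
  shows "has_average_headway L d h"
  unfolding has_average_headway_def sum_headway diff_divide_distrib
proof (intro allI impI)
  fix j assume "j < segments L"
  with assms have "(\<lambda>K. d K j / real K) \<longlonglongrightarrow> h"
    by (simp add: has_growth_rate_def)
  from tendsto_diff[OF this lim_const_over_n]
  show "(\<lambda>K. d K j / real K - d 0 j / real K) \<longlonglongrightarrow> h" by simp
qed

theorem theorem6: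
  fixes L :: metro_line and d :: "nat \<Rightarrow> nat \<Rightarrow> real"
  assumes "well_formed L"
    and "0 < num_trains L" and "num_trains L < segments L"
    and "maxplus_trajectory L d"
  shows "has_growth_rate L d (headway_formula L)
       \<and> has_average_headway L d (headway_formula L)"
proof -
  interpret metro_trajectory L d
    by unfold_locales (fact assms)+
  obtain v where "\<forall>j<n. A j \<le> v j - v (prv j) \<and> v j - v (prv j) \<le> B j"
    using ex_potential by blast
  then interpret metro_potential L d v
    by unfold_locales auto
  show ?thesis
    using growth_rate has_average_headway_if_has_growth_rate by blast
qed

end
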